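(* For each positive integer $n$, there exists a twisted knot $K_n$ whose arc shift number $A(K_n)$ is exactly equal to $n$.
   Context: **Twisted knots.** A twisted knot diagram is a generic closed oriented curve in $\mathbb{R}^2$ whose double points are each marked either as a classical crossing (with over/under information, hence a sign $\pm1$) or as a virtual crossing, and which carries finitely many bars (short transverse marks) placed on the curve away from the double points. Its Gauss diagram is an oriented circle parametrizing the curve, with one chord for each classical crossing joining its two preimages, directed from the over endpoint to the under endpoint and labelled with the sign, and with the bars recorded as marked points on the circle; virtual crossings are not recorded. Two diagrams are equivalent if they are related by planar isotopy and the extended Reidemeister moves: the classical moves $R_1,R_2,R_3$; the virtual moves $V_1,V_2,V_3,V_4$ (the Reidemeister moves with all crossings virtual, and the move passing a strand with only virtual crossings across a classical crossing); $T_1$ (a bar slides along its strand through a virtual crossing); $T_2$ (two adjacent bars on the same edge are created or deleted); and $T_3$ (whose effect on Gauss diagrams is: a chord has its direction reversed, its sign kept, and one bar is added on each of the four circle segments adjacent to its two endpoints, or the inverse). The moves $V_1$--$V_4,T_1$ do not change Gauss diagrams, and two diagrams are equivalent iff their Gauss diagrams are related by finitely many moves $R_1,R_2,R_3,T_2,T_3$ (no bars lie between the endpoints required to be adjacent in $R_1,R_2,R_3$). A twisted knot is an equivalence class of diagrams. A trivial twisted knot is the classical unknot (crossingless circle) with no bar or with one bar. **Arc shift move.** An arc $(a,b)$ of a diagram is a segment of the curve passing through exactly one pair of crossings $(c_1,c_2)$ (each classical or virtual), with end $a$ incident to $c_1$ and end $b$ incident to $c_2$; bars may or may not lie between the two crossings.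 The arc shift move on $(a,b)$ cuts the arc at two points near $a$ and near $b$ and reconnects the four loose ends so that the middle piece is traversed in the opposite direction; the middle piece, with its bars and the over/under information at $c_1,c_2$, is left in place, and all newly created crossings are virtual. Effect on the Gauss diagram: the order along the knot of the two endpoints belonging to the arc is interchanged (bars between them remain between them), and the signs of those of $c_1,c_2$ that are classical are changed (for $c_1\ne c_2$). **Arc shift number.** For a diagram $D$, $A(D)$ is the minimum number of arc shift moves required, together with any number of extended Reidemeister moves, to transform $D$ into a diagram of a trivial twisted knot. For a twisted knot $K$, $A(K)=\min\{A(D): D \text{ represents } K\}$. *)

theory Defs
  imports Main "HOL-Library.Extended_Nat"
begin

text \<open>
  A twisted knot diagram is encoded by the cyclic word read off while running once along the
  oriented curve.  Letters are the bars and the passages through crossings; a passage through a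
  classical crossing carries the crossing's name, its level (over or under) and the sign of the
  crossing, so that the chord of the Gauss diagram runs from the \<open>Over\<close> to the \<open>Under\<close> letter of
  the same name.  Words are linear; the choice of base point is removed by a rotation move.

  The planar picture itself is not recorded.  Every code comes from a planar diagram once further
  virtual crossings are added, and these can be kept off any prescribed arc; virtual crossings are
  invisible to equivalence, so a code may be thought of as listing only some of them.
\<close>

datatype level = Over | Under

datatype mark = Bar | Classical nat level int | Virtual nat

fun opposite :: "level \<Rightarrow> level" where
  "opposite Over = Under"
| "opposite Under = Over"

fun at_classical :: "nat \<Rightarrow> mark \<Rightarrow> bool" where
  "at_classical c (Classical d l s) \<longleftrightarrow> d = c"
| "at_classical c _ \<longleftrightarrow> False"

fun is_virtual :: "mark \<Rightarrow> bool" where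
  "is_virtual (Virtual v) \<longleftrightarrow> True"
| "is_virtual _ \<longleftrightarrow> False"

definition is_diagram :: "mark list \<Rightarrow> bool" where
  "is_diagram w \<longleftrightarrow>
     (\<forall>c. filter (at_classical c) w = [] \<or>
          (\<exists>l. \<exists>s\<in>{1, -1}.
             filter (at_classical c) w = [Classical c l s, Classical c (opposite l) s])) \<and>
     (\<forall>v. count_list w (Virtual v) \<in> {0, 2})"

definition gauss :: "mark list \<Rightarrow> mark list" where
  "gauss w = filter (\<lambda>m. \<not> is_virtual m) w"

fun relabel :: "(nat \<Rightarrow> nat) \<Rightarrow> mark \<Rightarrow> mark" where
  "relabel f (Classical c l s) = Classical (f c) l s"
| "relabel f (Virtual v) = Virtual v"
| "relabel f Bar = Bar"

fun reverse_chord :: "nat \<Rightarrow> mark \<Rightarrow> mark list" where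
  "reverse_chord c (Classical d l s) =
     (if d = c then [Bar, Classical d (opposite l) s, Bar] else [Classical d l s])"
| "reverse_chord c (Virtual v) = [Virtual v]"
| "reverse_chord c Bar = [Bar]"

definition directed :: "int \<Rightarrow> 'a list \<Rightarrow> 'a list" where
  "directed e xs = (if 0 < e then xs else rev xs)"

text \<open>
  In the third move, \<open>a\<close> is the crossing of the top with the middle strand, \<open>b\<close> of the top with the
  bottom strand and \<open>c\<close> of the middle with the bottom strand; their signs are \<open>p\<close>, \<open>q\<close>, \<open>r\<close>.
  For three oriented lines in general position in the plane (a crossing being positive iff the pair
  of directions (over, under) is positively oriented) the triangle can be shifted to one of two
  sides \<open>z = 1\<close>, \<open>z = -1\<close>.  The top strand meets \<open>a\<close> before \<open>b\<close> iff \<open>z q > 0\<close>, the middle strand meets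
  \<open>a\<close> before \<open>c\<close> iff \<open>z r > 0\<close>, and the bottom strand meets \<open>b\<close> before \<open>c\<close> iff \<open>z p q r > 0\<close>.
  The move changes \<open>z = 1\<close> to \<open>z = -1\<close>; all oriented versions of the move arise in this way.
\<close>

definition top_seg :: "int \<Rightarrow> nat \<Rightarrow> nat \<Rightarrow> int \<Rightarrow> int \<Rightarrow> mark list" where
  "top_seg z a b p q = directed (z * q) [Classical a Over p, Classical b Over q]"

definition middle_seg :: "int \<Rightarrow> nat \<Rightarrow> nat \<Rightarrow> int \<Rightarrow> int \<Rightarrow> mark list" where
  "middle_seg z a c p r = directed (z * r) [Classical a Under p, Classical c Over r]"

definition bottom_seg :: "int \<Rightarrow> nat \<Rightarrow> nat \<Rightarrow> int \<Rightarrow> int \<Rightarrow> int \<Rightarrow> mark list" where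
  "bottom_seg z b c p q r = directed (z * p * q * r) [Classical b Under q, Classical c Under r]"

text \<open>
  Moves are listed in one direction only and, where possible, at the base point.
  \<open>rotation\<close> and \<open>relabelling\<close> identify codes of the same diagram.
  \<open>virtual\<close> stands for V1--V4 and T1: two diagrams with the same Gauss diagram are related by
  these moves.
\<close>

inductive move :: "mark list \<Rightarrow> mark list \<Rightarrow> bool" where
  rotation: "move (u @ v) (v @ u)"
| relabelling: "inj f \<Longrightarrow> move w (map (relabel f) w)"
| virtual: "gauss w = gauss w' \<Longrightarrow> move w w'"
| R1: "move ([Classical c l s, Classical c (opposite l) s] @ u) u"
| R2_parallel:
    "move ([Classical c Over s, Classical d Over (-s)] @ u @
           [Classical c Under s, Classical d Under (-s)] @ v) (u @ v)"
| R2_antiparallel: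
    "move ([Classical c Over s, Classical d Over (-s)] @ u @
           [Classical d Under (-s), Classical c Under s] @ v) (u @ v)"
| R3_top_middle_bottom:
    "move (top_seg 1 a b p q @ u @ middle_seg 1 a c p r @ v @ bottom_seg 1 b c p q r @ w)
          (top_seg (-1) a b p q @ u @ middle_seg (-1) a c p r @ v @ bottom_seg (-1) b c p q r @ w)"
| R3_top_bottom_middle:
    "move (top_seg 1 a b p q @ u @ bottom_seg 1 b c p q r @ v @ middle_seg 1 a c p r @ w)
          (top_seg (-1) a b p q @ u @ bottom_seg (-1) b c p q r @ v @ middle_seg (-1) a c p r @ w)"
| T2: "move ([Bar, Bar] @ u) u"
| T3: "move w (concat (map (reverse_chord c) w))"

text \<open>All intermediate words have to be diagrams; this also makes created crossings new.\<close>

definition diagram_move :: "mark list \<Rightarrow> mark list \<Rightarrow> bool" where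
  "diagram_move D E \<longleftrightarrow> is_diagram D \<and> is_diagram E \<and> move D E"

definition equivalence :: "(mark list \<times> mark list) set" where
  "equivalence = {(D, E). is_diagram D \<and> is_diagram E \<and> equivclp diagram_move D E}"

definition twisted_knots :: "mark list set set" where
  "twisted_knots = Collect is_diagram // equivalence"

definition trivial_diagram :: "mark list \<Rightarrow> bool" where
  "trivial_diagram D \<longleftrightarrow> (D, []) \<in> equivalence \<or> (D, [Bar]) \<in> equivalence"

fun same_crossing :: "mark \<Rightarrow> mark \<Rightarrow> bool" where
  "same_crossing (Classical c l s) (Classical d l' s') \<longleftrightarrow> c = d"
| "same_crossing (Virtual v) (Virtual v') \<longleftrightarrow> v = v'"
| "same_crossing _ _ \<longleftrightarrow> False"

text \<open>\<open>switch_sign x\<close> changes the sign of the crossing passed at \<open>x\<close> if it is classical.\<close>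

fun switch_sign :: "mark \<Rightarrow> mark \<Rightarrow> mark" where
  "switch_sign (Classical c l' s') (Classical d l s) = Classical d l (if d = c then - s else s)"
| "switch_sign _ m = m"

text \<open>
  The arc passes \<open>x\<close> and then \<open>y\<close>, with \<open>k\<close> bars and no crossing in between; it may run over the
  base point, whence the rotation.  If both passages belong to one crossing, both of its strands
  are reversed and its sign stays.  The virtual crossings created by the move are
  unspecified, so only the Gauss diagram of the result is prescribed.
\<close>

definition shift_arc :: "mark \<Rightarrow> nat \<Rightarrow> mark \<Rightarrow> mark list \<Rightarrow> mark list" where
  "shift_arc x k y w =
     (let w' = y # replicate k Bar @ x # w
      in if same_crossing x y then w' else map (switch_sign x \<circ> switch_sign y) w')"

definition arc_shift :: "mark list \<Rightarrow> mark list \<Rightarrow> bool" where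
  "arc_shift D E \<longleftrightarrow> is_diagram D \<and> is_diagram E \<and>
     (\<exists>i x k y w. x \<noteq> Bar \<and> y \<noteq> Bar \<and> rotate i D = x # replicate k Bar @ y # w \<and>
                  gauss E = gauss (shift_arc x k y w))"

inductive transforms :: "nat \<Rightarrow> mark list \<Rightarrow> mark list \<Rightarrow> bool" where
  no_shift: "(D, E) \<in> equivalence \<Longrightarrow> transforms 0 D E"
| shift: "transforms k D E \<Longrightarrow> arc_shift E E' \<Longrightarrow> (E', F) \<in> equivalence \<Longrightarrow> transforms (Suc k) D F"

text \<open>The minimum over the empty set is \<open>\<infinity>\<close>.\<close>

definition diagram_arc_shift_number :: "mark list \<Rightarrow> enat" where
  "diagram_arc_shift_number D = Inf {enat k | k. \<exists>E. trivial_diagram E \<and> transforms k D E}"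

definition arc_shift_number :: "mark list set \<Rightarrow> enat" where
  "arc_shift_number K = (INF D\<in>K. diagram_arc_shift_number D)"

end

theory Submission
  imports Defs
begin

text \<open>
  The lower bound comes from the odd writhe.  Call a chord odd if the number of chord endpoints
  strictly between its two ends is odd; the odd writhe is the sum of the signs of the odd chords,
  bars being ignored.  It is an invariant of twisted knots: the chord of a first Reidemeister move
  is even, the two chords of a second move have equal parity and opposite signs, a third move
  interchanges neighbouring endpoints in such a way that every chord involved has both its ends
  moved by one place, and the twisted moves affect neither signs nor parities
  (\<open>four_odd_writhe_equivalence\<close>).

  An arc shift changes the odd writhe by at most two (\<open>four_odd_writhe_arc_shift\<close>).  When the arc
  joins passages of two different classical crossings, both chords change sign and parity: an odd
  chord of sign \<open>s\<close> stops contributing \<open>s\<close>, an even one starts contributing \<open>- s\<close>, so the writhe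
  drops by \<open>s\<close> for each of them.  When one passage is virtual, a single chord changes its sign, and
  its contribution at most goes from \<open>s\<close> to \<open>- s\<close>.  As trivial knots have odd writhe zero, a knot
  of odd writhe \<open>2 n\<close> needs at least \<open>n\<close> arc shifts.

  The connected sum of \<open>n\<close> positive virtual trefoils, each with Gauss code \<open>O1 O2 U1 U2\<close>, attains
  this bound: all its \<open>2 n\<close> chords are odd and positive, and interchanging \<open>O1\<close> and \<open>O2\<close> in one
  summand leaves two nested chords that first Reidemeister moves remove (\<open>unknot_one_trefoil\<close>).
\<close>

section \<open>Alternating sums over the crossing passages\<close>

fun is_classical :: "mark \<Rightarrow> bool" where
  "is_classical (Classical c l s) \<longleftrightarrow> True"
| "is_classical _ \<longleftrightarrow> False"

text \<open>The factor \<open>-1\<close> or \<open>1\<close> by which a prefix \<open>w\<close> changes the alternating sum of what follows it.\<close>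

definition passage_parity :: "mark list \<Rightarrow> int" where
  "passage_parity w = (-1) ^ length (filter is_classical w)"

text \<open>
  The signs alternate along the classical passages only; bars and virtual passages do not advance
  the alternation.
\<close>

fun alternating :: "(mark \<Rightarrow> int) \<Rightarrow> mark list \<Rightarrow> int" where
  "alternating f [] = 0"
| "alternating f (m # w) = (if is_classical m then f m - alternating f w else alternating f w)"

fun passage :: "nat \<Rightarrow> mark \<Rightarrow> int" where
  "passage c (Classical d l s) = (if d = c then 1 else 0)"
| "passage c _ = 0"

fun signed_passage :: "nat \<Rightarrow> mark \<Rightarrow> int" where
  "signed_passage c (Classical d l s) = (if d = c then s else 0)"
| "signed_passage c _ = 0"

text \<open>
  If a chord of sign \<open>s\<close> has its ends at the classical passages number \<open>i\<close> and \<open>j\<close>, the product is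
  \<open>s ((-1)\<^sup>i + (-1)\<^sup>j)\<^sup>2\<close>.  This is \<open>4 s\<close> if \<open>i\<close> and \<open>j\<close> are congruent modulo two, that is, if the
  chord is odd, and \<open>0\<close> otherwise.  In this form the parity of a chord is computed from sums that
  are compatible with concatenation of words.
\<close>

definition odd_contribution :: "nat \<Rightarrow> mark list \<Rightarrow> int" where
  "odd_contribution c w = alternating (passage c) w * alternating (signed_passage c) w"

definition crossing_names :: "mark list \<Rightarrow> nat set" where
  "crossing_names w = {c. filter (at_classical c) w \<noteq> []}"

definition four_odd_writhe :: "mark list \<Rightarrow> int" where
  "four_odd_writhe w = (\<Sum>c\<in>crossing_names w. odd_contribution c w)"

lemma is_classicalE:
  assumes "is_classical m"
  obtains c l s where "m = Classical c l s"
  using assms by (cases m) auto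

lemma passage_parity_simps [simp]:
  "passage_parity [] = 1"
  "passage_parity (m # w) = (if is_classical m then - passage_parity w else passage_parity w)"
  "passage_parity (u @ v) = passage_parity u * passage_parity v"
  by (simp_all add: passage_parity_def power_add)

lemma passage_parity_square [simp]: "passage_parity w * passage_parity w = 1"
  by (simp add: passage_parity_def flip: power_add)

lemma alternating_append [simp]:
  "alternating f (u @ v) = alternating f u + passage_parity u * alternating f v"
  by (induction u) (auto simp: algebra_simps)

lemma alternating_replicate_Bar [simp]: "alternating f (replicate k Bar) = 0"
  and passage_parity_replicate_Bar [simp]: "passage_parity (replicate k Bar) = 1"
  and filter_replicate_Bar [simp]: "filter (at_classical c) (replicate k Bar) = []"
  by (induction k) auto

lemma crossing_names_Nil [simp]: "crossing_names [] = {}"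
  by (simp add: crossing_names_def)

lemma crossing_names_Cons [simp]:
  "crossing_names (m # w) = {c. at_classical c m} \<union> crossing_names w"
  by (auto simp: crossing_names_def)

lemma crossing_names_append [simp]:
  "crossing_names (u @ v) = crossing_names u \<union> crossing_names v"
  by (auto simp: crossing_names_def)

lemma finite_crossing_names [simp]: "finite (crossing_names w)"
proof (induction w)
  case (Cons m w)
  then show ?case by (cases m) auto
qed simp

lemma alternating_absent:
  assumes "filter (at_classical c) w = []"
  shows "alternating (passage c) w = 0" "alternating (signed_passage c) w = 0"
proof -
  have "alternating (passage c) w = 0 \<and> alternating (signed_passage c) w = 0"
    using assms
  proof (induction w)
    case (Cons m w)
    then show ?case by (cases m) (auto split: if_splits)
  qed simp
  then show "alternating (passage c) w = 0" "alternating (signed_passage c) w = 0"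
    by auto
qed

lemma alternating_single:
  assumes "filter (at_classical c) w = [Classical c l s]"
  shows "\<exists>e\<in>{1, -1}. alternating (passage c) w = e \<and> alternating (signed_passage c) w = s * e"
  using assms
proof (induction w)
  case (Cons m w)
  show ?case
  proof (cases "at_classical c m")
    case True
    with Cons.prems show ?thesis
      by (auto simp: alternating_absent)
  next
    case False
    with Cons.prems have "\<exists>e\<in>{1, -1}. alternating (passage c) w = e \<and> alternating (signed_passage c) w = s * e"
      by (intro Cons.IH) simp
    with False show ?thesis
      by (cases m) auto
  qed
qed simp

lemma odd_contribution_absent:
  "c \<notin> crossing_names w \<Longrightarrow> odd_contribution c w = 0"
  by (simp add: crossing_names_def odd_contribution_def alternating_absent)

text \<open>
  Comparison of two words whose sets of crossings may differ: only the crossings at which the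
  contributions differ matter, since absent crossings contribute zero.
\<close>

lemma four_odd_writhe_change:
  assumes "finite T" "\<And>c. c \<notin> T \<Longrightarrow> odd_contribution c w' = odd_contribution c w"
  shows "four_odd_writhe w' - four_odd_writhe w
       = (\<Sum>c\<in>T. odd_contribution c w' - odd_contribution c w)"
proof -
  define S where "S = crossing_names w \<union> crossing_names w' \<union> T"
  have S: "finite S" using assms(1) by (simp add: S_def)
  have *: "four_odd_writhe v = (\<Sum>c\<in>S. odd_contribution c v)" if "crossing_names v \<subseteq> S" for v
    unfolding four_odd_writhe_def
    by (rule sum.mono_neutral_left) (use that S odd_contribution_absent in auto)
  have "four_odd_writhe w' - four_odd_writhe w
      = (\<Sum>c\<in>S. odd_contribution c w' - odd_contribution c w)"
    by (subst (1 2) *) (auto simp: S_def sum_subtractf)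
  also have "\<dots> = (\<Sum>c\<in>T. odd_contribution c w' - odd_contribution c w)"
    by (rule sum.mono_neutral_right) (use S assms in \<open>auto simp: S_def\<close>)
  finally show ?thesis .
qed

lemma four_odd_writhe_cong:
  assumes "\<And>c. odd_contribution c w' = odd_contribution c w"
  shows "four_odd_writhe w' = four_odd_writhe w"
  using four_odd_writhe_change[of "{}" w' w] assms by simp

section \<open>Chords of a diagram\<close>

lemma diagram_chord:
  assumes "is_diagram w" "filter (at_classical c) w \<noteq> []"
  obtains l s where "s \<in> {1, -1}"
    "filter (at_classical c) w = [Classical c l s, Classical c (opposite l) s]"
  using assms unfolding is_diagram_def by blast

lemma diagram_chord_length:
  assumes "is_diagram w"
  shows "length (filter (at_classical c) w) \<in> {0, 2}"
proof (cases "filter (at_classical c) w = []")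
  case False
  show ?thesis by (rule diagram_chord[OF assms False]) simp
qed simp

lemma diagram_sign:
  assumes "is_diagram w" "Classical c l s \<in> set w"
  shows "s \<in> {1, -1}"
proof -
  have mem: "Classical c l s \<in> set (filter (at_classical c) w)" using assms(2) by simp
  then have "filter (at_classical c) w \<noteq> []" by (metis empty_iff list.set(1))
  then show ?thesis
    by (rule diagram_chord[OF assms(1)]) (use mem in auto)
qed

lemma length_filter_is_classical:
  assumes "finite S" "crossing_names w \<subseteq> S"
  shows "length (filter is_classical w) = (\<Sum>c\<in>S. length (filter (at_classical c) w))"
  using assms(2)
proof (induction w)
  case (Cons m w)
  have "crossing_names w \<subseteq> S"
    using Cons.prems by simp
  note IH = Cons.IH[OF this]
  show ?case
  proof (cases m)
    case (Classical d l s)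
    then have "d \<in> S"
      using Cons.prems by auto
    have "(\<Sum>c\<in>S. length (filter (at_classical c) (m # w)))
        = (\<Sum>c\<in>S. (if c = d then 1 else 0) + length (filter (at_classical c) w))"
      by (rule sum.cong) (auto simp: Classical)
    also have "\<dots> = Suc (length (filter is_classical w))"
      using assms(1) \<open>d \<in> S\<close> by (simp add: sum.distrib IH)
    finally show ?thesis by (simp add: Classical)
  qed (use IH in auto)
qed simp

text \<open>
  Every classical crossing is passed twice, so the alternation closes up along the whole knot.  This
  is what makes the parity of a chord independent of the base point.
\<close>

lemma diagram_passage_parity:
  assumes "is_diagram w"
  shows "passage_parity w = 1"
proof -
  have "even (length (filter (at_classical c) w))" for c
    using diagram_chord_length[OF assms, of c] by auto
  then have "even (length (filter is_classical w))"
    by (simp add: length_filter_is_classical[OF finite_crossing_names order_refl] dvd_sum)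
  then show ?thesis by (simp add: passage_parity_def)
qed

lemma odd_contribution_bound:
  assumes "is_diagram w"
  shows "\<bar>odd_contribution c w\<bar> \<le> 4"
proof (cases "filter (at_classical c) w = []")
  case True
  then show ?thesis by (simp add: odd_contribution_def alternating_absent)
next
  case False
  obtain l s where s: "s \<in> {1, -1}"
    and f: "filter (at_classical c) w = [Classical c l s, Classical c (opposite l) s]"
    by (rule diagram_chord[OF assms False])
  obtain u v where w: "w = u @ Classical c l s # v"
    and "\<forall>m\<in>set u. \<not> at_classical c m"
    and v: "[Classical c (opposite l) s] = filter (at_classical c) v"
    using filter_eq_ConsD[OF f] by blast
  then have u: "filter (at_classical c) u = []" by simp
  obtain e where "e \<in> {1, -1}" "alternating (passage c) v = e"
    "alternating (signed_passage c) v = s * e"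
    using alternating_single[OF v[symmetric]] by blast
  moreover have "passage_parity u \<in> {1, -1}"
    by (simp add: passage_parity_def minus_one_power_iff)
  ultimately show ?thesis
    using s u by (auto simp: odd_contribution_def w alternating_absent)
qed

section \<open>Invariance under the moves\<close>

lemma alternating_gauss [simp]: "alternating f (gauss w) = alternating f w"
proof (induction w)
  case (Cons m w)
  then show ?case by (cases m) (auto simp: gauss_def)
qed (simp add: gauss_def)

lemma four_odd_writhe_gauss [simp]: "four_odd_writhe (gauss w) = four_odd_writhe w"
  by (rule four_odd_writhe_cong) (simp add: odd_contribution_def)

text \<open>
  A new base point shifts the positions of all passages by the same amount, so it multiplies both
  factors of every contribution by one common sign.
\<close>

lemma four_odd_writhe_rotation:
  assumes "is_diagram (u @ v)"
  shows "four_odd_writhe (v @ u) = four_odd_writhe (u @ v)"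
proof (rule four_odd_writhe_cong)
  fix c
  have uv: "passage_parity u * passage_parity v = 1"
    using diagram_passage_parity[OF assms] by simp
  have "passage_parity v = passage_parity u"
    using uv by (metis mult.commute mult.left_commute mult.right_neutral passage_parity_square)
  then have *: "alternating f (v @ u) = passage_parity u * alternating f (u @ v)" for f
    by (simp add: algebra_simps flip: mult.assoc)
  have "odd_contribution c (v @ u)
      = (passage_parity u * passage_parity u) * odd_contribution c (u @ v)"
    unfolding odd_contribution_def * by (simp only: ac_simps)
  then show "odd_contribution c (v @ u) = odd_contribution c (u @ v)"
    by simp
qed

lemma four_odd_writhe_relabelling:
  assumes "inj f"
  shows "four_odd_writhe (map (relabel f) w) = four_odd_writhe w"
proof -
  have eq: "at_classical (f c) (relabel f m) = at_classical c m" for c m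
    using assms by (cases m) (auto dest: injD)
  have names: "crossing_names (map (relabel f) w) = f ` crossing_names w"
  proof (rule set_eqI)
    fix d
    show "d \<in> crossing_names (map (relabel f) w) \<longleftrightarrow> d \<in> f ` crossing_names w"
    proof
      assume "d \<in> crossing_names (map (relabel f) w)"
      then obtain m where m: "m \<in> set w" "at_classical d (relabel f m)"
        by (auto simp: crossing_names_def filter_empty_conv)
      obtain c where "d = f c" by (cases m) (use m in auto)
      with m show "d \<in> f ` crossing_names w"
        by (auto simp: crossing_names_def filter_empty_conv eq)
    qed (auto simp: crossing_names_def filter_empty_conv eq)
  qed
  have "alternating (passage (f c)) (map (relabel f) w) = alternating (passage c) w \<and>
        alternating (signed_passage (f c)) (map (relabel f) w) = alternating (signed_passage c) w" for c
  proof (induction w)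
    case (Cons m w)
    then show ?case using assms by (cases m) (auto dest: injD)
  qed simp
  then show ?thesis
    unfolding four_odd_writhe_def names
    by (subst sum.reindex) (use assms in \<open>auto simp: odd_contribution_def intro: inj_on_subset\<close>)
qed

text \<open>The two ends of an isolated chord occupy consecutive positions and cancel.\<close>

lemma four_odd_writhe_R1:
  "four_odd_writhe ([Classical c l s, Classical c l' s] @ u) = four_odd_writhe u"
  by (rule four_odd_writhe_cong) (simp add: odd_contribution_def)

text \<open>
  The ends of \<open>c\<close> and \<open>d\<close> are neighbours on both strands, whence the chords have equal parity; their
  signs are opposite, so their contributions cancel.  That intermediate words are diagrams
  guarantees that \<open>c\<close> and \<open>d\<close> are distinct and occur nowhere else.
\<close>

lemma four_odd_writhe_R2:
  assumes D: "is_diagram ([Classical c Over s, Classical d Over (-s)] @ u @ seg @ v)"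
    and seg: "seg = [Classical c Under s, Classical d Under (-s)] \<or>
              seg = [Classical d Under (-s), Classical c Under s]"
  shows "four_odd_writhe ([Classical c Over s, Classical d Over (-s)] @ u @ seg @ v)
       = four_odd_writhe (u @ v)"
    (is "four_odd_writhe ?w = _")
proof -
  have "c \<noteq> d"
    using diagram_chord_length[OF D, of c] seg by auto
  moreover from this have "filter (at_classical c) u = []" "filter (at_classical c) v = []"
    "filter (at_classical d) u = []" "filter (at_classical d) v = []"
    using diagram_chord_length[OF D, of c] diagram_chord_length[OF D, of d] seg by auto
  ultimately have sum0: "(\<Sum>e\<in>{c, d}. odd_contribution e ?w - odd_contribution e (u @ v)) = 0"
    using seg by (auto simp: odd_contribution_def alternating_absent algebra_simps)
  have same: "odd_contribution e ?w = odd_contribution e (u @ v)" if "e \<notin> {c, d}" for e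
    using seg that by (auto simp: odd_contribution_def add.commute)
  have "four_odd_writhe ?w - four_odd_writhe (u @ v)
      = (\<Sum>e\<in>{c, d}. odd_contribution e ?w - odd_contribution e (u @ v))"
    by (rule four_odd_writhe_change[OF _ same]) auto
  with sum0 show ?thesis by linarith
qed

lemma four_odd_writhe_T3:
  "four_odd_writhe (concat (map (reverse_chord c) w)) = four_odd_writhe w"
proof (rule four_odd_writhe_cong)
  fix d
  have "alternating (passage d) (concat (map (reverse_chord c) w)) = alternating (passage d) w \<and>
    alternating (signed_passage d) (concat (map (reverse_chord c) w)) = alternating (signed_passage d) w"
  proof (induction w)
    case (Cons m w)
    then show ?case by (cases m) auto
  qed simp
  then show "odd_contribution d (concat (map (reverse_chord c) w)) = odd_contribution d w"
    by (simp add: odd_contribution_def)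
qed


text \<open>
  For nonzero signs the third move just reverses each of the three segments, and reversing two
  adjacent passages negates their alternating sum.
\<close>

lemma alternating_triangle_segs:
  assumes "p \<in> {1, -1}" "q \<in> {1, -1}" "r \<in> {1, -1}"
  shows "alternating f (top_seg (-1) a b p q) = - alternating f (top_seg 1 a b p q)"
    and "alternating f (middle_seg (-1) a c p r) = - alternating f (middle_seg 1 a c p r)"
    and "alternating f (bottom_seg (-1) b c p q r) = - alternating f (bottom_seg 1 b c p q r)"
  using assms by (auto simp: top_seg_def middle_seg_def bottom_seg_def directed_def)

lemma passage_parity_triangle_segs:
  "passage_parity (top_seg z a b p q) = 1"
  "passage_parity (middle_seg z a c p r) = 1"
  "passage_parity (bottom_seg z b c p q r) = 1"
  by (auto simp: top_seg_def middle_seg_def bottom_seg_def directed_def)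

lemma filter_triangle_segs:
  assumes "e \<notin> {a, b, c}"
  shows "filter (at_classical e) (top_seg z a b p q) = []"
    and "filter (at_classical e) (middle_seg z a c p r) = []"
    and "filter (at_classical e) (bottom_seg z b c p q r) = []"
  using assms by (auto simp: top_seg_def middle_seg_def bottom_seg_def directed_def)

lemma length_filter_triangle_segs:
  assumes "e \<in> {a, b, c}"
  shows "length (filter (at_classical e) (top_seg z a b p q)) +
         length (filter (at_classical e) (middle_seg z a c p r)) +
         length (filter (at_classical e) (bottom_seg z b c p q r)) \<ge> 2"
  using assms by (auto simp: top_seg_def middle_seg_def bottom_seg_def directed_def)

lemma set_triangle_segs:
  "set (top_seg z a b p q) = {Classical a Over p, Classical b Over q}"
  "set (middle_seg z a c p r) = {Classical a Under p, Classical c Over r}"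
  by (auto simp: top_seg_def middle_seg_def directed_def)

text \<open>
  A chord with both ends in the segments has both factors of its contribution negated; a chord with
  no end there is unaffected.  The hypothesis \<open>apart\<close> excludes chords of mixed kind.
\<close>

lemma four_odd_writhe_swap_segments:
  assumes parity: "passage_parity X = 1" "passage_parity Y = 1" "passage_parity Z = 1"
      "passage_parity X' = 1" "passage_parity Y' = 1" "passage_parity Z' = 1"
    and swap: "\<And>f. alternating f X' = - alternating f X" "\<And>f. alternating f Y' = - alternating f Y"
      "\<And>f. alternating f Z' = - alternating f Z"
    and apart: "\<And>e. filter (at_classical e) (X @ Y @ Z) = [] \<or> filter (at_classical e) (u @ v @ w) = []"
  shows "four_odd_writhe (X' @ u @ Y' @ v @ Z' @ w) = four_odd_writhe (X @ u @ Y @ v @ Z @ w)"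
proof (rule four_odd_writhe_cong)
  fix e
  from apart[of e] show "odd_contribution e (X' @ u @ Y' @ v @ Z' @ w)
      = odd_contribution e (X @ u @ Y @ v @ Z @ w)"
  proof
    assume "filter (at_classical e) (X @ Y @ Z) = []"
    then show ?thesis
      by (simp add: odd_contribution_def parity swap alternating_absent)
  next
    assume "filter (at_classical e) (u @ v @ w) = []"
    then show ?thesis
      by (simp add: odd_contribution_def parity swap alternating_absent algebra_simps)
  qed
qed

lemma four_odd_writhe_R3:
  fixes a b c :: nat and p q r :: int
  defines "M \<equiv> \<lambda>z. middle_seg z a c p r" and "B \<equiv> \<lambda>z. bottom_seg z b c p q r"
  assumes D: "is_diagram (top_seg 1 a b p q @ u @ Y 1 @ v @ Z 1 @ w)" (is "is_diagram ?D")
    and YZ: "Y = M \<and> Z = B \<or> Y = B \<and> Z = M"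
  shows "four_odd_writhe (top_seg (-1) a b p q @ u @ Y (-1) @ v @ Z (-1) @ w) = four_odd_writhe ?D"
proof -
  have letters: "Classical a Over p \<in> set ?D" "Classical b Over q \<in> set ?D" "Classical c Over r \<in> set ?D"
    using YZ by (auto simp: M_def set_triangle_segs)
  note signs = letters[THEN diagram_sign[OF D]]
  note alternating = alternating_triangle_segs[OF signs]
  show ?thesis
  proof (rule four_odd_writhe_swap_segments)
    fix e
    let ?count = "\<lambda>w. length (filter (at_classical e) w)"
    show "filter (at_classical e) (top_seg 1 a b p q @ Y 1 @ Z 1) = []
        \<or> filter (at_classical e) (u @ v @ w) = []"
    proof (cases "e \<in> {a, b, c}")
      case True
      \<comment> \<open>The triangle already uses up the two passages through each of its crossings.\<close>
      have "?count (top_seg 1 a b p q @ Y 1 @ Z 1) \<ge> 2"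
        using length_filter_triangle_segs[OF True, of 1 p q r] YZ by (auto simp: M_def B_def)
      moreover have "?count (top_seg 1 a b p q @ Y 1 @ Z 1) + ?count (u @ v @ w) \<in> {0, 2}"
        using diagram_chord_length[OF D, of e] by (simp add: ac_simps)
      moreover have "k = 0" if "m \<ge> 2" "m + k \<in> {0, 2}" for m k :: nat
        using that by auto
      ultimately have "?count (u @ v @ w) = 0" by blast
      then show ?thesis unfolding length_0_conv by (rule disjI2)
    next
      case False
      then show ?thesis
        using YZ filter_triangle_segs[OF False] by (auto simp: M_def B_def)
    qed
  qed (use alternating passage_parity_triangle_segs YZ in \<open>auto simp: M_def B_def\<close>)
qed

lemma four_odd_writhe_move:
  assumes "move D E" "is_diagram D"
  shows "four_odd_writhe E = four_odd_writhe D"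
  using assms
proof (induction rule: move.induct)
  case (rotation u v)
  then show ?case by (rule four_odd_writhe_rotation)
next
  case (relabelling f w)
  then show ?case by (intro four_odd_writhe_relabelling)
next
  case (virtual w w')
  then show ?case by (metis four_odd_writhe_gauss)
next
  case (R1 c l s u)
  show ?case by (rule four_odd_writhe_R1[symmetric])
next
  case (R2_parallel c s d u v)
  then show ?case by (intro four_odd_writhe_R2[symmetric]) auto
next
  case (R2_antiparallel c s d u v)
  then show ?case by (intro four_odd_writhe_R2[symmetric]) auto
next
  case (R3_top_middle_bottom a b p q u c r v w)
  then show ?case by (intro four_odd_writhe_R3) auto
next
  case (R3_top_bottom_middle a b p q u c r v w)
  then show ?case by (intro four_odd_writhe_R3) auto
next
  case (T2 u)
  show ?case by (rule four_odd_writhe_cong) (simp add: odd_contribution_def)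
next
  case (T3 w c)
  show ?case by (rule four_odd_writhe_T3)
qed

lemma four_odd_writhe_equivalence:
  assumes "(D, E) \<in> equivalence"
  shows "four_odd_writhe E = four_odd_writhe D"
proof -
  have "equivclp diagram_move D E" using assms by (simp add: equivalence_def)
  then show ?thesis
    by (induction rule: equivclp_induct) (auto simp: diagram_move_def dest: four_odd_writhe_move)
qed

lemma four_odd_writhe_trivial:
  assumes "trivial_diagram D"
  shows "four_odd_writhe D = 0"
proof -
  have "four_odd_writhe [] = 0" "four_odd_writhe [Bar] = 0"
    by (simp_all add: four_odd_writhe_def crossing_names_def)
  with assms show ?thesis
    unfolding trivial_diagram_def by (auto dest: four_odd_writhe_equivalence)
qed

section \<open>The effect of an arc shift\<close>

lemma switch_sign_is_classical [simp]: "is_classical (switch_sign x m) = is_classical m"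
  by (cases "(x, m)" rule: switch_sign.cases) auto

lemma passage_parity_switch_sign [simp]:
  "passage_parity (map (switch_sign x) w) = passage_parity w"
  by (induction w) auto

lemma odd_contribution_switch_sign:
  "odd_contribution c (map (switch_sign x) w)
   = (if at_classical c x then - odd_contribution c w else odd_contribution c w)"
proof -
  have "passage c (switch_sign x m) = passage c m" for m
    by (cases "(x, m)" rule: switch_sign.cases) auto
  then have "alternating (passage c) (map (switch_sign x) w) = alternating (passage c) w"
    by (induction w) auto
  moreover have "signed_passage c (switch_sign x m)
      = (if at_classical c x then - signed_passage c m else signed_passage c m)" for m
    by (cases "(x, m)" rule: switch_sign.cases) auto
  then have "alternating (signed_passage c) (map (switch_sign x) w) =
    (if at_classical c x then - alternating (signed_passage c) w else alternating (signed_passage c) w)"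
    by (induction w) auto
  ultimately show ?thesis
    by (simp add: odd_contribution_def)
qed

lemma shift_arc_distinct:
  assumes "\<not> same_crossing x y"
  shows "shift_arc x k y w = map (switch_sign x) (map (switch_sign y) (y # replicate k Bar @ x # w))"
  using assms by (simp add: shift_arc_def)

text \<open>
  Exchanging neighbouring passages of two different crossings changes the parity of both chords, and
  the signs change as well.  An odd chord loses its contribution \<open>4 s\<close>, and an even one receives
  \<open>- 4 s\<close>: in either case the difference is \<open>- 4 s\<close>.
\<close>

lemma odd_contribution_swap_change:
  assumes D: "is_diagram D"
    and D_eq: "D = x # replicate k Bar @ y # w"
    and xy: "is_classical x" "is_classical y" "\<not> same_crossing x y"
    and c: "at_classical c x \<or> at_classical c y"
  shows "\<bar>odd_contribution c (shift_arc x k y w) - odd_contribution c D\<bar> \<le> 4"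
proof -
  obtain cx lx sx where x: "x = Classical cx lx sx"
    using xy(1) by (rule is_classicalE)
  obtain cy ly sy where y: "y = Classical cy ly sy"
    using xy(2) by (rule is_classicalE)
  have ne: "cx \<noteq> cy" using xy by (simp add: x y)
  obtain l s where "s \<in> {1, -1}"
    and "filter (at_classical c) D = [Classical c l s, Classical c (opposite l) s]"
    by (rule diagram_chord[OF D, of c]) (use c in \<open>auto simp: D_eq\<close>)
  moreover from this have w: "filter (at_classical c) w = [Classical c (opposite l) s]"
    and "(c = cx \<and> sx = s) \<or> (c = cy \<and> sy = s)"
    using c ne by (auto simp: D_eq x y)
  moreover obtain e where "e \<in> {1, -1}" "alternating (passage c) w = e"
    "alternating (signed_passage c) w = s * e"
    using alternating_single[OF w] by blast
  ultimately show ?thesis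
    using ne unfolding shift_arc_distinct[OF xy(3)] odd_contribution_switch_sign
    by (auto simp: D_eq x y odd_contribution_def)
qed

text \<open>
  Eight is attained both with two classical passages, whose chords account for four each, and with
  a single one, whose contribution may change from \<open>4\<close> to \<open>-4\<close>.  An arc whose ends are passages
  of the same crossing changes nothing, because the level of a passage does not enter.
\<close>

lemma four_odd_writhe_shift_arc:
  assumes D: "is_diagram D"
    and D_eq: "D = x # replicate k Bar @ y # w"
    and xy: "x \<noteq> Bar" "y \<noteq> Bar"
  shows "\<bar>four_odd_writhe (shift_arc x k y w) - four_odd_writhe D\<bar> \<le> 8"
proof (cases "same_crossing x y")
  case True
  have "odd_contribution c (y # replicate k Bar @ x # w) = odd_contribution c D" for c
  proof (cases x)
    case (Classical d l s)
    with True obtain l' s' where y: "y = Classical d l' s'" by (cases y) auto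
    have "s' = s"
      by (rule diagram_chord[OF D, of d]) (auto simp: D_eq Classical y)
    then show ?thesis
      by (simp add: D_eq y Classical odd_contribution_def)
  qed (use True xy in \<open>cases y; simp add: D_eq odd_contribution_def\<close>)+
  then have "four_odd_writhe (y # replicate k Bar @ x # w) = four_odd_writhe D"
    by (rule four_odd_writhe_cong)
  with True show ?thesis by (simp add: shift_arc_def)
next
  case False
  define w' where "w' = y # replicate k Bar @ x # w"
  have shift: "shift_arc x k y w = map (switch_sign x) (map (switch_sign y) w')"
    unfolding w'_def by (rule shift_arc_distinct[OF False])
  show ?thesis
  proof (cases "is_classical x \<and> is_classical y")
    case True
    obtain cx lx sx where x: "x = Classical cx lx sx"
      using True is_classicalE by blast
    obtain cy ly sy where y: "y = Classical cy ly sy"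
      using True is_classicalE by blast
    let ?\<Delta> = "\<lambda>c. odd_contribution c (shift_arc x k y w) - odd_contribution c D"
    have "?\<Delta> c = 0" if "c \<notin> {cx, cy}" for c
      using that unfolding shift odd_contribution_switch_sign
      by (simp add: w'_def D_eq x y odd_contribution_def)
    then have "four_odd_writhe (shift_arc x k y w) - four_odd_writhe D = (\<Sum>c\<in>{cx, cy}. ?\<Delta> c)"
      by (intro four_odd_writhe_change) auto
    moreover have "cx \<noteq> cy" using False by (simp add: x y)
    moreover have "\<bar>?\<Delta> c\<bar> \<le> 4" if "c \<in> {cx, cy}" for c
      using odd_contribution_swap_change[OF D D_eq _ _ False, of c] True that
      by (auto simp: x y)
    from this[of cx] this[of cy] have "\<bar>?\<Delta> cx\<bar> \<le> 4" "\<bar>?\<Delta> cy\<bar> \<le> 4" by auto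
    ultimately show ?thesis by simp
  next
    case virtual: False
    \<comment> \<open>No two classical passages are interchanged, so all positions stay as they are.\<close>
    have same: "odd_contribution c w' = odd_contribution c D" for c
      using virtual by (auto simp: w'_def D_eq odd_contribution_def)
    show ?thesis
    proof (cases "\<exists>c. at_classical c x \<or> at_classical c y")
      case True
      then obtain c where c: "at_classical c x \<or> at_classical c y" by blast
      have only: "(at_classical d x \<noteq> at_classical d y) = (d = c)"
        and off: "d \<noteq> c \<Longrightarrow> \<not> at_classical d x \<and> \<not> at_classical d y" for d
        using c virtual by (cases x; cases y; auto)+
      have change: "odd_contribution d (shift_arc x k y w)
          = (if d = c then - odd_contribution d D else odd_contribution d D)" for d
        unfolding shift odd_contribution_switch_sign same using only[of d] off[of d] by auto
      have "four_odd_writhe (shift_arc x k y w) - four_odd_writhe D = - 2 * odd_contribution c D"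
        using four_odd_writhe_change[of "{c}" "shift_arc x k y w" D] by (simp add: change)
      then show ?thesis
        using odd_contribution_bound[OF D, of c] by linarith
    next
      case False
      then have "four_odd_writhe (shift_arc x k y w) = four_odd_writhe D"
        by (intro four_odd_writhe_cong)
          (simp add: shift odd_contribution_switch_sign same del: map_map)
      then show ?thesis by simp
    qed
  qed
qed

lemma rotate_two_letters:
  assumes "u @ v = [a, b]"
  shows "v @ u = [a, b] \<or> v @ u = [b, a]"
  using assms by (auto simp: append_eq_Cons_conv)

lemma is_diagram_rotate:
  assumes D: "is_diagram (u @ v)"
  shows "is_diagram (v @ u)"
  unfolding is_diagram_def
proof (intro conjI allI)
  fix c
  let ?chord = "\<lambda>w. \<exists>l. \<exists>s\<in>{1, -1}. w = [Classical c l s, Classical c (opposite l) s]"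
  show "filter (at_classical c) (v @ u) = [] \<or> ?chord (filter (at_classical c) (v @ u))"
  proof (cases "filter (at_classical c) (u @ v) = []")
    case False
    obtain l s where s: "s \<in> {1, -1}"
      and f: "filter (at_classical c) (u @ v) = [Classical c l s, Classical c (opposite l) s]"
      by (rule diagram_chord[OF D False])
    have "opposite (opposite l) = l" by (cases l) auto
    moreover have "filter (at_classical c) (v @ u) = [Classical c l s, Classical c (opposite l) s] \<or>
        filter (at_classical c) (v @ u) = [Classical c (opposite l) s, Classical c l s]"
      using rotate_two_letters[OF f[unfolded filter_append]] by simp
    ultimately have "?chord (filter (at_classical c) (v @ u))"
      using s by metis
    then show ?thesis by blast
  qed auto
next
  fix x
  show "count_list (v @ u) (Virtual x) \<in> {0, 2}"
    using D by (simp add: is_diagram_def add.commute)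
qed

lemma four_odd_writhe_arc_shift:
  assumes "arc_shift D E"
  shows "\<bar>four_odd_writhe E - four_odd_writhe D\<bar> \<le> 8"
proof -
  obtain i x k y w where D: "is_diagram D" and xy: "x \<noteq> Bar" "y \<noteq> Bar"
    and rot: "rotate i D = x # replicate k Bar @ y # w"
    and E: "gauss E = gauss (shift_arc x k y w)"
    using assms unfolding arc_shift_def by blast
  obtain u v where uv: "D = u @ v" "rotate i D = v @ u"
    by (metis append_take_drop_id rotate_drop_take)
  have "is_diagram (rotate i D)" "four_odd_writhe (rotate i D) = four_odd_writhe D"
    unfolding uv(2) using D is_diagram_rotate four_odd_writhe_rotation by (auto simp: uv(1))
  moreover have "four_odd_writhe E = four_odd_writhe (shift_arc x k y w)"
    by (metis E four_odd_writhe_gauss)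
  ultimately show ?thesis
    using four_odd_writhe_shift_arc[OF _ rot xy] by simp
qed

lemma four_odd_writhe_transforms:
  assumes "transforms k D E"
  shows "\<bar>four_odd_writhe E - four_odd_writhe D\<bar> \<le> 8 * int k"
  using assms
proof induction
  case (no_shift D E)
  then show ?case by (simp add: four_odd_writhe_equivalence)
next
  case (shift k D E E' F)
  then show ?case
    using four_odd_writhe_arc_shift[of E E'] four_odd_writhe_equivalence[of E' F] by auto
qed

lemma diagram_arc_shift_number_ge:
  assumes "8 * int n \<le> \<bar>four_odd_writhe D\<bar>"
  shows "enat n \<le> diagram_arc_shift_number D"
  unfolding diagram_arc_shift_number_def
proof (rule Inf_greatest)
  fix a
  assume "a \<in> {enat k | k. \<exists>E. trivial_diagram E \<and> transforms k D E}"
  then obtain k E where "a = enat k" "trivial_diagram E" "transforms k D E" by blast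
  with assms show "enat n \<le> a"
    using four_odd_writhe_transforms[of k D E] four_odd_writhe_trivial[of E] by auto
qed

section \<open>Connected sums of virtual trefoils\<close>

fun trefoil_sum :: "nat \<Rightarrow> mark list" where
  "trefoil_sum 0 = []"
| "trefoil_sum (Suc m) =
     [Classical (2 * m) Over 1, Classical (2 * m + 1) Over 1,
      Classical (2 * m) Under 1, Classical (2 * m + 1) Under 1] @ trefoil_sum m"

lemma insert_chord:
  assumes D: "is_diagram (u @ v @ w)" and new: "c \<notin> crossing_names (u @ v @ w)"
    and "s \<in> {1, -1}" "l' = opposite l"
  shows "is_diagram (u @ Classical c l s # v @ Classical c l' s # w)"
proof -
  let ?w = "u @ Classical c l s # v @ Classical c l' s # w"
  show ?thesis
    unfolding is_diagram_def
  proof (intro conjI allI)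
    fix d
    let ?chord = "\<lambda>w. \<exists>l. \<exists>s\<in>{1, -1}. w = [Classical d l s, Classical d (opposite l) s]"
    show "filter (at_classical d) ?w = [] \<or> ?chord (filter (at_classical d) ?w)"
    proof (cases "d = c")
      case True
      have "filter (at_classical c) ?w = [Classical c l s, Classical c (opposite l) s]"
        using new assms(4) by (simp add: crossing_names_def)
      with True assms(3) show ?thesis by blast
    next
      case False
      then have "filter (at_classical d) ?w = filter (at_classical d) (u @ v @ w)" by simp
      then show ?thesis using D unfolding is_diagram_def by (simp only:)
    qed
  next
    fix x
    show "count_list ?w (Virtual x) \<in> {0, 2}"
      using D by (simp add: is_diagram_def)
  qed
qed

lemma crossing_names_trefoil_sum: "crossing_names (trefoil_sum m) = {..<2 * m}"
proof (induction m)
  case (Suc m)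
  show ?case by (simp add: Suc set_eq_iff) auto
qed simp

lemma is_diagram_trefoil_sum: "is_diagram (trefoil_sum m)"
proof (induction m)
  case 0
  show ?case by (simp add: is_diagram_def)
next
  case (Suc m)
  have "is_diagram ([] @ Classical (2 * m) Over 1 # [] @ Classical (2 * m) Under 1 # trefoil_sum m)"
    by (rule insert_chord) (use Suc in \<open>auto simp: crossing_names_trefoil_sum\<close>)
  then have "is_diagram ([Classical (2 * m) Over 1] @ Classical (2 * m + 1) Over 1 #
      [Classical (2 * m) Under 1] @ Classical (2 * m + 1) Under 1 # trefoil_sum m)"
    by (intro insert_chord) (auto simp: crossing_names_trefoil_sum)
  then show ?case by simp
qed

lemma four_odd_writhe_trefoil_sum: "four_odd_writhe (trefoil_sum m) = 8 * int m"
proof (induction m)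
  case 0
  show ?case by (simp add: four_odd_writhe_def)
next
  case (Suc m)
  have "2 * m \<notin> crossing_names (trefoil_sum m)" "Suc (2 * m) \<notin> crossing_names (trefoil_sum m)"
    by (simp_all add: crossing_names_trefoil_sum)
  then have absent: "filter (at_classical (2 * m)) (trefoil_sum m) = []"
    "filter (at_classical (Suc (2 * m))) (trefoil_sum m) = []"
    by (simp_all add: crossing_names_def)
  have "four_odd_writhe (trefoil_sum (Suc m)) - four_odd_writhe (trefoil_sum m)
      = (\<Sum>c\<in>{2 * m, 2 * m + 1}. odd_contribution c (trefoil_sum (Suc m)) - odd_contribution c (trefoil_sum m))"
    by (rule four_odd_writhe_change) (auto simp: odd_contribution_def)
  also have "\<dots> = 8"
    by (simp add: odd_contribution_def alternating_absent[OF absent(1)] alternating_absent[OF absent(2)])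
  finally show ?case using Suc by simp
qed

lemma equivalenceI:
  assumes "is_diagram D" "is_diagram E" "move D E"
  shows "(D, E) \<in> equivalence"
  using assms by (auto simp: equivalence_def diagram_move_def)

lemma equivalence_refl: "is_diagram D \<Longrightarrow> (D, D) \<in> equivalence"
  by (simp add: equivalence_def)

lemma equivalence_trans [trans]:
  "(D, E) \<in> equivalence \<Longrightarrow> (E, F) \<in> equivalence \<Longrightarrow> (D, F) \<in> equivalence"
  by (auto simp: equivalence_def intro: equivclp_trans)

lemma map_switch_sign_absent:
  assumes "\<And>c. at_classical c x \<Longrightarrow> c \<notin> crossing_names w"
  shows "map (switch_sign x) w = w"
proof (rule map_idI)
  fix m
  assume "m \<in> set w"
  then have "at_classical c m \<Longrightarrow> c \<in> crossing_names w" for c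
    by (auto simp: crossing_names_def filter_empty_conv)
  with assms show "switch_sign x m = m"
    by (cases "(x, m)" rule: switch_sign.cases) auto
qed

lemma unknot_one_trefoil:
  "\<exists>E. arc_shift (trefoil_sum (Suc m)) E \<and> (E, trefoil_sum m) \<in> equivalence"
proof -
  let ?c = "2 * m" and ?d = "Suc (2 * m)" and ?K = "trefoil_sum m"
  let ?x = "Classical ?c Over 1" and ?y = "Classical ?d Over 1"
  let ?E = "[Classical ?d Over (-1), Classical ?c Over (-1),
             Classical ?c Under (-1), Classical ?d Under (-1)] @ ?K"
  let ?rest = "[Classical ?d Under (-1)] @ ?K"
  \<comment> \<open>\<open>?E\<close> is the word after the shift.  The inner chord \<open>?c\<close> is removed first; as first Reidemeister
    moves apply at the base point only, the word is rotated before each of them.\<close>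
  note K = is_diagram_trefoil_sum[of m]
  have one: "is_diagram ([] @ Classical ?d Over (-1) # [] @ Classical ?d Under (-1) # ?K)"
    by (rule insert_chord) (use K in \<open>auto simp: crossing_names_trefoil_sum\<close>)
  then have "is_diagram ([Classical ?d Over (-1)] @ Classical ?c Over (-1) #
      [] @ Classical ?c Under (-1) # ?rest)"
    by (intro insert_chord) (auto simp: crossing_names_trefoil_sum)
  then have E: "is_diagram ?E" by simp
  have [simp]: "map (switch_sign ?x) ?K = ?K" "map (switch_sign ?y) ?K = ?K"
    by (auto intro!: map_switch_sign_absent simp: crossing_names_trefoil_sum)
  have "shift_arc ?x 0 ?y ([Classical ?c Under 1, Classical ?d Under 1] @ ?K) = ?E"
    by (simp add: shift_arc_def flip: map_map)
  moreover have "rotate 0 (trefoil_sum (Suc m)) =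
      ?x # replicate 0 Bar @ ?y # [Classical ?c Under 1, Classical ?d Under 1] @ ?K"
    by simp
  ultimately have shift: "arc_shift (trefoil_sum (Suc m)) ?E"
    unfolding arc_shift_def using E is_diagram_trefoil_sum[of "Suc m"]
    by (metis mark.distinct(1))

  let ?F = "([Classical ?c Over (-1), Classical ?c Under (-1)] @ ?rest) @ [Classical ?d Over (-1)]"
  let ?G = "?rest @ [Classical ?d Over (-1)]"
  let ?H = "[Classical ?d Over (-1)] @ ?rest"
  have F: "is_diagram ?F"
    by (rule is_diagram_rotate) (use E in simp)
  have G: "is_diagram ?G"
    by (rule is_diagram_rotate) (use one in simp)
  have H: "is_diagram ?H" using one by simp
  have "(?E, ?F) \<in> equivalence"
    using equivalenceI[OF _ F move.rotation] E by simp
  also have "(?F, ?G) \<in> equivalence"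
    using equivalenceI[OF F G] move.R1[of ?c Over "-1" ?G] by simp
  also have "(?G, ?H) \<in> equivalence"
    by (rule equivalenceI[OF G H move.rotation])
  also have "(?H, ?K) \<in> equivalence"
    using equivalenceI[OF H K] move.R1[of ?d Over "-1" ?K] by simp
  finally show ?thesis using shift by blast
qed

lemma unknot_trefoils: "transforms k (trefoil_sum (k + m)) (trefoil_sum m)"
proof (induction k arbitrary: m)
  case 0
  show ?case by (simp add: transforms.no_shift equivalence_refl is_diagram_trefoil_sum)
next
  case (Suc k)
  from Suc.IH[of "Suc m"] show ?case
    using unknot_one_trefoil[of m] by (auto intro: transforms.shift)
qed

theorem theorem3p1:
  fixes n :: nat
  assumes "n > 0"
  shows "\<exists>K\<in>twisted_knots. arc_shift_number K = enat n"
proof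
  let ?K = "equivalence `` {trefoil_sum n}"
  show "?K \<in> twisted_knots"
    unfolding twisted_knots_def by (rule quotientI) (simp add: is_diagram_trefoil_sum)
  have "trivial_diagram []"
    by (simp add: trivial_diagram_def equivalence_refl is_diagram_def)
  then have "diagram_arc_shift_number (trefoil_sum n) \<le> enat n"
    unfolding diagram_arc_shift_number_def
    using unknot_trefoils[of n 0] by (intro Inf_lower) auto
  moreover have "trefoil_sum n \<in> ?K"
    by (simp add: equivalence_refl is_diagram_trefoil_sum)
  ultimately have "arc_shift_number ?K \<le> enat n"
    unfolding arc_shift_number_def by (rule INF_lower2[rotated])
  moreover have "enat n \<le> arc_shift_number ?K"
    unfolding arc_shift_number_def
  proof (rule INF_greatest)
    fix D
    assume "D \<in> ?K"
    then have "four_odd_writhe D = 8 * int n"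
      using four_odd_writhe_equivalence[of "trefoil_sum n" D]
      by (simp add: four_odd_writhe_trefoil_sum)
    then show "enat n \<le> diagram_arc_shift_number D"
      by (intro diagram_arc_shift_number_ge) simp
  qed
  ultimately show "arc_shift_number ?K = enat n" by (rule antisym)
qed

end
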